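(* Let $A$ be a commutative ring, let $n\ge 1$, and let $T=(t_{ij})$ be an $n\times n$ skew symmetric matrix with entries in $A$ and with zeros on the diagonal (that is, $t_{ji}=-t_{ij}$ and $t_{ii}=0$ for all $i,j$). Let $R$ and $S$ be subsets (not necessarily disjoint) of $\{1,\ldots,n\}$ of the same cardinality $m$, with elements $r_1<\cdots<r_m$ and $s_1<\cdots<s_m$, respectively. Set $\rho=r_1\ldots r_m$ and $\sigma=s_1\ldots s_m$, regarded as words in the letters $1,\ldots,n$. Then $$\det(T[R;S]) = (-1)^{\left\lfloor \frac{m}{2}\right\rfloor}\sum_{k=0}^{\left\lfloor \frac{m}{2}\right\rfloor}(-1)^k\sum_{\substack{|\omega|=2k\\ \omega\subseteq\rho}}\operatorname{sgn}\begin{pmatrix}\rho\\ \omega(\rho\setminus\omega)\end{pmatrix}\,\mathcal{P}[\omega]\,\mathcal{P}[(\rho\setminus\omega)\sigma],$$ where the inner sum is over all subwords $\omega$ of $\rho$ of length $2k$.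
   Context: For subsets $R,S\subseteq\{1,\ldots,n\}$, $T[R;S]$ denotes the submatrix of $T$ obtained by taking the rows indexed by $R$ and the columns indexed by $S$ (in increasing order). Words: a word is a finite sequence of letters from $\{1,\ldots,n\}$; $|\omega|$ denotes the length of $\omega$, and juxtaposition of words denotes concatenation. For a word $\rho$ with distinct letters, $\omega\subseteq\rho$ means that $\omega$ is a subword of $\rho$, i.e. obtained from $\rho$ by deleting some (possibly none or all) letters and keeping the remaining ones in order; $\rho\setminus\omega$ is the word obtained from $\rho$ by deleting the letters of $\omega$. If $\alpha$ and $\beta$ are words without repeated letters that have the same letters, $\operatorname{sgn}\begin{pmatrix}\alpha\\ \beta\end{pmatrix}\in\{1,-1\}$ is the sign of the permutation that rearranges $\alpha$ into $\beta$. The function $\mathcal{P}$: set $\mathcal{P}[ij]=t_{ij}$ for $i,j\in\{1,\ldots,n\}$ and extend $\mathcal{P}$ to a function from words to $A$ as follows. The value on the empty word is $1$. The value on any word with a repeated letter is $0$. The value on any word of odd length is $0$. For a word $i_1\ldots i_{2k}$ of even length with distinct letters, $$\mathcal{P}[i_1\ldots i_{2k}]=\sum \operatorname{sgn}\begin{pmatrix}i_1\ldots i_{2k}\\ j_1\ldots j_{2k}\end{pmatrix}\,\mathcal{P}[j_1j_2]\cdots\mathcal{P}[j_{2k-1}j_{2k}],$$ where the sum is over all (unordered) partitions $\{\{j_1,j_2\},\ldots,\{j_{2k-1},j_{2k}\}\}$ of the set $\{i_1,\ldots,i_{2k}\}$ into $k$ subsets of cardinality $2$, each partition counted once; the summand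 does not depend on the order of the subsets or on the order of the two elements in each subset. (Thus for $r_1<\cdots<r_m$, $\mathcal{P}[r_1\ldots r_m]$ is the Pfaffian of $T[R;R]$ with $R=\{r_1,\ldots,r_m\}$.) *)

theory Defs
  imports
    "Jordan_Normal_Form.Determinant"
    "Jordan_Normal_Form.DL_Submatrix"
    "HOL-Library.Sublist"
    "HOL-Library.Disjoint_Sets"
    "HOL-Combinatorics.Permutations"
begin

text \<open>
  Matrices are indexed from \<open>0\<close>, so the alphabet \<open>{1, \<dots>, n}\<close> becomes \<open>{0..<n}\<close>. A word is a list,
  and \<open>\<omega> \<subseteq> \<rho>\<close> is \<^const>\<open>subseq\<close>.
\<close>

definition word_minus :: "'b list \<Rightarrow> 'b list \<Rightarrow> 'b list" where
  "word_minus \<rho> \<omega> = filter (\<lambda>x. x \<notin> set \<omega>) \<rho>"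

text \<open>
  The permutation of positions that rearranges \<open>\<alpha>\<close> into \<open>\<beta>\<close> is unique when \<open>\<alpha>\<close> and \<open>\<beta>\<close> are distinct
  lists with the same elements; the value is irrelevant otherwise.
\<close>

definition word_sgn :: "'b list \<Rightarrow> 'b list \<Rightarrow> int" where
  "word_sgn \<alpha> \<beta> = sign (THE p. p permutes {..<length \<alpha>} \<and> permute_list p \<alpha> = \<beta>)"

definition pair_partitions :: "'b set \<Rightarrow> 'b set set set" where
  "pair_partitions X = {M. partition_on X M \<and> (\<forall>B\<in>M. card B = 2)}"

text \<open>
  \<open>j\<^sub>1 \<dots> j\<^sub>2\<^sub>k\<close> lists the partition \<open>{{j\<^sub>1, j\<^sub>2}, \<dots>, {j\<^sub>2\<^sub>k\<^sub>-\<^sub>1, j\<^sub>2\<^sub>k}}\<close>, in any order of the blocks and with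
  any order of the two elements of each block.
\<close>

definition lists_pairs :: "'b list \<Rightarrow> 'b set set \<Rightarrow> bool" where
  "lists_pairs js M \<longleftrightarrow> distinct js \<and> even (length js) \<and>
     M = (\<lambda>i. {js ! (2 * i), js ! (2 * i + 1)}) ` {..<length js div 2}"

text \<open>
  For an alternating matrix the summand does not depend on which listing of \<open>M\<close> is chosen.
\<close>

definition pf_term :: "'a::comm_ring_1 mat \<Rightarrow> nat list \<Rightarrow> nat set set \<Rightarrow> 'a" where
  "pf_term T w M =
     (let js = (SOME js. lists_pairs js M)
      in of_int (word_sgn w js) *
         (\<Prod>i<length js div 2. T $$ (js ! (2 * i), js ! (2 * i + 1))))"

definition pf :: "'a::comm_ring_1 mat \<Rightarrow> nat list \<Rightarrow> 'a" where
  "pf T w =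
     (if distinct w \<and> even (length w) then \<Sum>M\<in>pair_partitions (set w). pf_term T w M else 0)"

lemma word_sgn_permute_list:
  assumes "distinct w" "p permutes {..<length w}"
  shows "word_sgn w (permute_list p w) = sign p"
proof -
  have "q = p" if q: "q permutes {..<length w}" "permute_list q w = permute_list p w" for q
  proof
    fix i
    show "q i = p i"
    proof (cases "i < length w")
      case True
      then have "w ! q i = w ! p i"
        using q assms by (metis permute_list_nth)
      moreover have "q i < length w" "p i < length w"
        using True q(1) assms(2) permutes_in_image by (metis lessThan_iff)+
      ultimately show ?thesis
        using assms(1) nth_eq_iff_index_eq by metis
    next
      case False
      then show ?thesis
        using q(1) assms(2) by (simp add: permutes_def)
    qed
  qed
  then have "(THE q. q permutes {..<length w} \<and> permute_list q w = permute_list p w) = p"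
    using assms(2) by (intro the_equality) auto
  then show ?thesis
    by (simp add: word_sgn_def)
qed

lemma pf_Nil: "pf T [] = 1"
proof -
  have 1: "pair_partitions {} = {{} :: nat set set}"
    by (auto simp: pair_partitions_def partition_on_def)
  have "lists_pairs (SOME js. lists_pairs js ({} :: nat set set)) ({} :: nat set set)"
    by (rule someI[of _ "[]"]) (simp add: lists_pairs_def)
  then have "(SOME js. lists_pairs js ({} :: nat set set)) = []"
    by (cases "SOME js. lists_pairs js ({} :: nat set set)")
       (auto simp: lists_pairs_def lessThan_empty_iff elim!: oddE evenE)
  then show ?thesis
    using word_sgn_permute_list[of "[]::nat list" id]
    by (simp add: pf_def 1 pf_term_def Let_def permutes_id sign_id)
qed

lemma pf_pair:
  assumes "i \<noteq> j" "T $$ (j, i) = - T $$ (i, j)"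
  shows "pf T [i, j] = T $$ (i, j)"
proof -
  have 1: "pair_partitions {i, j} = {{{i, j}}}"
  proof (intro equalityI subsetI)
    fix M assume "M \<in> pair_partitions {i, j}"
    then have M: "\<Union>M = {i, j}" "\<And>B. B \<in> M \<Longrightarrow> card B = 2"
      by (auto simp: pair_partitions_def partition_on_def)
    have "B = {i, j}" if "B \<in> M" for B
    proof (rule card_subset_eq)
      show "B \<subseteq> {i, j}" using M(1) that by blast
      show "card B = card {i, j}" using M(2)[OF that] assms(1) by simp
    qed simp
    moreover have "M \<noteq> {}" using M(1) by auto
    ultimately show "M \<in> {{{i, j}}}" by auto
  next
    fix M assume "M \<in> {{{i, j}}}"
    then show "M \<in> pair_partitions {i, j}"
      using assms(1) by (auto simp: pair_partitions_def partition_on_def disjoint_def)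
  qed
  define js where "js = (SOME js. lists_pairs js {{i, j}})"
  have "lists_pairs js {{i, j}}"
    unfolding js_def
    by (rule someI[of _ "[i, j]"]) (use assms(1) in \<open>simp add: lists_pairs_def lessThan_Suc\<close>)
  then have js: "distinct js" "even (length js)"
      "{{i, j}} = (\<lambda>k. {js ! (2 * k), js ! (2 * k + 1)}) ` {..<length js div 2}"
    by (auto simp: lists_pairs_def)
  have "length js = 2"
  proof -
    let ?f = "\<lambda>k. {js ! (2 * k), js ! (2 * k + 1)}"
    have "inj_on ?f {..<length js div 2}"
    proof (rule inj_onI)
      fix a b assume ab: "a \<in> {..<length js div 2}" "b \<in> {..<length js div 2}" "?f a = ?f b"
      then have "js ! (2 * a) = js ! (2 * b) \<or> js ! (2 * a) = js ! (2 * b + 1)" by blast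
      moreover have "2 * a < length js" "2 * b < length js" "2 * b + 1 < length js"
        using ab(1,2) by auto
      ultimately have "2 * a = 2 * b \<or> 2 * a = 2 * b + 1"
        using js(1) nth_eq_iff_index_eq by metis
      then show "a = b" by presburger
    qed
    then have "card (?f ` {..<length js div 2}) = length js div 2"
      by (simp add: card_image)
    then have "length js div 2 = 1"
      unfolding js(3)[symmetric] by simp
    then show ?thesis using js(2) by auto
  qed
  then obtain a b where ab: "js = [a, b]"
    by (auto simp: length_Suc_conv numeral_2_eq_2)
  with js(3) have "{a, b} = {i, j}" by (simp add: lessThan_Suc)
  then consider "js = [i, j]" | "js = [j, i]"
    using ab assms(1) by (auto simp: doubleton_eq_iff)
  then have "of_int (word_sgn [i, j] js) * T $$ (js ! 0, js ! 1) = T $$ (i, j)"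
  proof cases
    case 1
    then show ?thesis
      using word_sgn_permute_list[of "[i, j]" id] assms(1) by (simp add: permutes_id sign_id)
  next
    case 2
    let ?p = "transpose (0::nat) 1"
    have "?p permutes {..<length [i, j]}"
      by (rule permutes_swap_id) auto
    moreover have "permute_list ?p [i, j] = [j, i]"
      by (simp add: permute_list_def upt_rec)
    ultimately have "word_sgn [i, j] js = -1"
      using word_sgn_permute_list[of "[i, j]" ?p] assms(1) 2 by (simp add: sign_swap_id)
    then show ?thesis using 2 assms(2) by simp
  qed
  moreover have "pf T [i, j] = of_int (word_sgn [i, j] js) * T $$ (js ! 0, js ! 1)"
    using assms(1) ab by (simp add: pf_def 1 pf_term_def Let_def js_def[symmetric] lessThan_Suc)
  ultimately show ?thesis by simp
qed

end

theory Submission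
  imports Defs
begin

text \<open>
  Replace the \<open>\<rho>\<rho>\<close> block of the matrix on the word \<open>\<rho>\<sigma>\<close> by zero by adding minus that block. The expansion
  of the Pfaffian of a sum of two alternating matrices turns the right-hand side, up to the sign,
  into the Pfaffian of the resulting matrix, whose vanishing block leaves only a determinant. On the
  level of recursions: expand both Pfaffians along the first letter \<open>x\<close> of \<open>\<rho>\<close>. The terms that pair
  \<open>x\<close> with another letter of \<open>\<rho>\<close> occur once with \<open>x\<close> in \<open>\<omega>\<close> and once with \<open>x\<close> outside \<open>\<omega>\<close>, with opposite
  signs; the surviving terms pair \<open>x\<close> with a letter of \<open>\<sigma>\<close> and form the Laplace expansion of the
  determinant along its first row.
\<close>

subsection \<open>Signs of rearrangements\<close>

lemma word_sgn_self: "distinct u \<Longrightarrow> word_sgn u u = 1"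
  using word_sgn_permute_list[of u id] by (simp add: permutes_id)

text \<open>If \<open>p\<close> carries \<open>u\<close> to \<open>v\<close> and \<open>q\<close>
  carries \<open>v\<close> to \<open>w\<close>, then \<open>p \<circ> q\<close> carries
  \<open>u\<close> to \<open>w\<close>, and \<open>sign\<close> is multiplicative. Later signs are
  computed by factoring a rearrangement through intermediate words.\<close>

lemma word_sgn_trans:
  assumes "distinct u" "mset v = mset u" "mset w = mset u"
  shows "word_sgn u w = word_sgn u v * word_sgn v w"
proof -
  obtain p where p: "p permutes {..<length u}" "permute_list p u = v"
    using mset_eq_permutation[OF assms(2)] by blast
  have "mset w = mset v" using assms by simp
  then obtain q where q: "q permutes {..<length v}" "permute_list q v = w"
    using mset_eq_permutation by blast
  have len: "length v = length u" using assms(2) by (rule mset_eq_length)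
  have "distinct v" using assms(1,2) by (metis mset_eq_imp_distinct_iff)
  have "p \<circ> q permutes {..<length u}"
    using p(1) q(1) len by (metis permutes_compose)
  moreover have "permute_list (p \<circ> q) u = w"
    using p q len by (metis permute_list_compose)
  ultimately have "word_sgn u w = sign (p \<circ> q)"
    using word_sgn_permute_list[OF assms(1)] by blast
  also have "\<dots> = sign p * sign q"
    using p(1) q(1) by (intro sign_compose) (auto intro: permutes_imp_permutation[rotated])
  finally show ?thesis
    using word_sgn_permute_list[OF assms(1) p(1)] word_sgn_permute_list[OF \<open>distinct v\<close> q(1)]
      p(2) q(2) by simp
qed

lemma word_sgn_sym:
  assumes "distinct u" "mset v = mset u"
  shows "word_sgn v u = word_sgn u v"
proof -
  have "word_sgn u v * word_sgn v u = 1"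
    using word_sgn_trans[OF assms, of u] assms(1) by (simp add: word_sgn_self)
  then show ?thesis by (auto simp: zmult_eq_1_iff)
qed

lemma word_sgn_Cons:
  assumes "distinct (x # u)" "mset v = mset u"
  shows "word_sgn (x # u) (x # v) = word_sgn u v"
proof -
  obtain p where p: "p permutes {..<length u}" "permute_list p u = v"
    using mset_eq_permutation[OF assms(2)] by blast
  \<comment> \<open>\<open>p\<close> is shifted by one position, so that position 0 of the leading
    \<open>x\<close> stays fixed.\<close>
  let ?q = "map_permutation {..<length u} Suc p"
  have "?q permutes Suc ` {..<length u}"
    using p(1) by (intro map_permutation_permutes) (auto simp: bij_betw_def)
  then have q: "?q permutes {..<length (x # u)}"
    by (rule permutes_subset) auto
  have "?q 0 = 0"
    using \<open>?q permutes Suc ` {..<length u}\<close> by (auto simp: permutes_def)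
  moreover have "?q (Suc i) = Suc (p i)" if "i < length u" for i
    using map_permutation_apply[of Suc "{..<length u}" i p] that by simp
  ultimately have "permute_list ?q (x # u) = x # v"
    unfolding p(2)[symmetric]
    by (intro nth_equalityI) (auto simp: permute_list_def nth_Cons' less_Suc_eq_0_disj
        simp del: upt_Suc)
  then have "word_sgn (x # u) (x # v) = sign ?q"
    using word_sgn_permute_list[OF assms(1) q] by simp
  also have "\<dots> = sign p"
    using p(1) by (intro sign_map_permutation) auto
  finally show ?thesis
    using word_sgn_permute_list[of u p] p assms(1) by simp
qed

lemma word_sgn_swap:
  assumes "distinct (x # y # u)"
  shows "word_sgn (x # y # u) (y # x # u) = -1"
proof -
  let ?p = "transpose (0::nat) 1"
  have p: "?p permutes {..<length (x # y # u)}"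
    by (rule permutes_swap_id) auto
  have "permute_list ?p (x # y # u) = y # x # u"
    by (intro nth_equalityI)
       (auto simp: permute_list_def nth_Cons' transpose_def simp del: upt_Suc)
  then show ?thesis
    using word_sgn_permute_list[OF assms p] by (simp add: sign_swap_id)
qed

text \<open>One adjacent swap for each letter of \<open>a\<close> that \<open>x\<close>
  passes.\<close>

lemma word_sgn_move:
  assumes "distinct (a @ x # b)"
  shows "word_sgn (a @ x # b) (x # a @ b) = (-1) ^ length a"
  using assms
proof (induction a)
  case Nil
  then show ?case by (simp add: word_sgn_self)
next
  case (Cons c a)
  have "word_sgn (c # a @ x # b) (x # c # a @ b)
      = word_sgn (c # a @ x # b) (c # x # a @ b) * word_sgn (c # x # a @ b) (x # c # a @ b)"
    using Cons.prems by (intro word_sgn_trans) auto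
  moreover have "word_sgn (c # a @ x # b) (c # x # a @ b) = word_sgn (a @ x # b) (x # a @ b)"
    using Cons.prems by (intro word_sgn_Cons) auto
  moreover have "word_sgn (c # x # a @ b) (x # c # a @ b) = -1"
    using Cons.prems by (intro word_sgn_swap) auto
  ultimately show ?case using Cons by simp
qed

subsection \<open>Signed sums over deletions and splittings\<close>

text \<open>
  \<open>del_sum u \<Psi>\<close> runs over all ways to take one letter out of \<open>u\<close>, and \<open>split_sum u \<Phi>\<close> over all ways to
  split \<open>u\<close> into two complementary subwords; positions are distinguished, so letters may repeat.
\<close>

primrec del_sum :: "'b list \<Rightarrow> ('b \<Rightarrow> 'b list \<Rightarrow> 'a::comm_ring_1) \<Rightarrow> 'a" where
  "del_sum [] \<Psi> = 0"
| "del_sum (x # u) \<Psi> = \<Psi> x u - del_sum u (\<lambda>y v. \<Psi> y (x # v))"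

primrec split_sum :: "'b list \<Rightarrow> ('b list \<Rightarrow> 'b list \<Rightarrow> 'a::comm_ring_1) \<Rightarrow> 'a" where
  "split_sum [] \<Phi> = \<Phi> [] []"
| "split_sum (x # u) \<Phi> = split_sum u (\<lambda>\<alpha> \<beta>. \<Phi> (x # \<alpha>) \<beta> + (-1) ^ length \<alpha> * \<Phi> \<alpha> (x # \<beta>))"

section \<open>Linearity, congruence and exchange rules for the signed sums\<close>

lemma del_sum_0: "del_sum u (\<lambda>y v. 0) = 0"
  by (induction u) auto

lemma del_sum_add: "del_sum u (\<lambda>y v. \<Phi> y v + \<Psi> y v) = del_sum u \<Phi> + del_sum u \<Psi>"
  by (induction u arbitrary: \<Phi> \<Psi>) auto

lemma del_sum_mult: "del_sum u (\<lambda>y v. c * \<Phi> y v) = c * del_sum u \<Phi>"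
  by (induction u arbitrary: \<Phi>) (auto simp: algebra_simps)

lemma del_sum_uminus: "del_sum u (\<lambda>y v. - \<Phi> y v) = - del_sum u \<Phi>"
  by (induction u arbitrary: \<Phi>) auto

lemma del_sum_diff: "del_sum u (\<lambda>y v. \<Phi> y v - \<Psi> y v) = del_sum u \<Phi> - del_sum u \<Psi>"
  by (induction u arbitrary: \<Phi> \<Psi>) auto

text \<open>The premise records that \<open>y\<close> and \<open>v\<close> together make up
  \<open>u\<close>; later this gives the length of \<open>v\<close>, on which signs and induction
  hypotheses depend.\<close>

lemma del_sum_cong:
  assumes "\<And>y v. mset u = add_mset y (mset v) \<Longrightarrow> \<Phi> y v = \<Psi> y v"
  shows "del_sum u \<Phi> = del_sum u \<Psi>"
  using assms
proof (induction u arbitrary: \<Phi> \<Psi>)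
  case (Cons x u)
  have "del_sum u (\<lambda>y v. \<Phi> y (x # v)) = del_sum u (\<lambda>y v. \<Psi> y (x # v))"
    by (rule Cons.IH) (auto intro!: Cons.prems)
  then show ?case using Cons.prems[of x u] by simp
qed simp

lemma del_sum_append:
  "del_sum (u @ w) \<Psi> = del_sum u (\<lambda>y v. \<Psi> y (v @ w)) + (-1) ^ length u * del_sum w (\<lambda>y v. \<Psi> y (u @ v))"
  by (induction u arbitrary: \<Psi>) (auto simp: algebra_simps)

text \<open>Each subtraction in the recursion stands for one passed letter, so the deletion at
  position \<open>i\<close> has sign \<open>(-1) ^ i\<close>. This is the link to the Laplace
  expansion.\<close>

lemma del_sum_eq_sum:
  "del_sum u \<Psi> = (\<Sum>i<length u. (-1) ^ i * \<Psi> (u ! i) (take i u @ drop (Suc i) u))"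
  by (induction u arbitrary: \<Psi>) (auto simp: sum.lessThan_Suc_shift sum_negf simp del: sum.lessThan_Suc)

text \<open>Taking the same two letters in the other order reverses the sign, so for symmetric
  \<open>\<Theta>\<close> the terms cancel in pairs; nothing is divided by 2.\<close>

lemma del_sum_del_sum_symmetric:
  assumes "\<And>y z v. \<Theta> y z v = \<Theta> z y v"
  shows "del_sum u (\<lambda>y v. del_sum v (\<Theta> y)) = 0"
  using assms
proof (induction u arbitrary: \<Theta>)
  case (Cons x u)
  have "del_sum u (\<lambda>y v. del_sum v (\<lambda>z w. \<Theta> y z (x # w))) = 0"
    by (rule Cons.IH) (rule Cons.prems)
  moreover have "del_sum u (\<lambda>y v. \<Theta> y x v) = del_sum u (\<lambda>y v. \<Theta> x y v)"
    by (rule del_sum_cong) (rule Cons.prems)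
  ultimately show ?case by (simp add: del_sum_diff)
qed simp

lemma split_sum_add: "split_sum u (\<lambda>\<alpha> \<beta>. \<Phi> \<alpha> \<beta> + \<Psi> \<alpha> \<beta>) = split_sum u \<Phi> + split_sum u \<Psi>"
  by (induction u arbitrary: \<Phi> \<Psi>) (auto simp: algebra_simps)

lemma split_sum_mult: "split_sum u (\<lambda>\<alpha> \<beta>. c * \<Phi> \<alpha> \<beta>) = c * split_sum u \<Phi>"
proof (induction u arbitrary: \<Phi>)
  case (Cons x u)
  show ?case
    by simp (subst Cons.IH[symmetric], simp add: algebra_simps)
qed simp

lemma split_sum_uminus: "split_sum u (\<lambda>\<alpha> \<beta>. - \<Phi> \<alpha> \<beta>) = - split_sum u \<Phi>"
  using split_sum_mult[of u "-1" \<Phi>] by simp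

lemma split_sum_diff: "split_sum u (\<lambda>\<alpha> \<beta>. \<Phi> \<alpha> \<beta> - \<Psi> \<alpha> \<beta>) = split_sum u \<Phi> - split_sum u \<Psi>"
  by (induction u arbitrary: \<Phi> \<Psi>) (auto simp: algebra_simps)

lemma split_sum_0: "split_sum u (\<lambda>\<alpha> \<beta>. 0) = 0"
  by (induction u) auto

lemma split_sum_cong:
  assumes "\<And>\<alpha> \<beta>. mset u = mset \<alpha> + mset \<beta> \<Longrightarrow> \<Phi> \<alpha> \<beta> = \<Psi> \<alpha> \<beta>"
  shows "split_sum u \<Phi> = split_sum u \<Psi>"
  using assms
proof (induction u arbitrary: \<Phi> \<Psi>)
  case (Cons x u)
  show ?case by simp (rule Cons.IH, simp add: Cons.prems)
qed simp

text \<open>Both sides run over the rearrangements of \<open>u\<close> into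
  \<open>y # \<alpha>' @ \<beta>\<close> with the same sign, whether \<open>y\<close> is taken out
  before or after the splitting.\<close>

lemma split_sum_del_sum_left:
  "split_sum u (\<lambda>\<alpha> \<beta>. del_sum \<alpha> (\<lambda>y \<alpha>'. \<Phi> y \<alpha>' \<beta>)) = del_sum u (\<lambda>y v. split_sum v (\<Phi> y))"
proof (induction u arbitrary: \<Phi>)
  case (Cons z u)
  \<comment> \<open>\<open>\<alpha>'\<close> is one letter shorter than \<open>\<alpha>\<close>,
    hence the change of sign.\<close>
  have "(-1) ^ length \<alpha> * del_sum \<alpha> (\<lambda>y \<alpha>'. \<Phi> y \<alpha>' (z # \<beta>))
      = - del_sum \<alpha> (\<lambda>y \<alpha>'. (-1) ^ length \<alpha>' * \<Phi> y \<alpha>' (z # \<beta>))" for \<alpha> \<beta>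
    unfolding del_sum_mult[symmetric] del_sum_uminus[symmetric]
    by (rule del_sum_cong) (auto dest: mset_eq_length[where xs = \<alpha> and ys = "_ # _", simplified])
  then show ?case
    by (simp add: split_sum_add split_sum_diff Cons.IH[symmetric] del_sum_add algebra_simps split_sum_mult
      flip: Cons.IH)
qed simp


text \<open>Here \<open>y\<close> comes from the right part and must also pass
  \<open>\<alpha>\<close>, hence the factor \<open>(-1) ^ length \<alpha>\<close>. The right-hand
  side is that of \<open>split_sum_del_sum_left\<close>, which yields the cancellation in
  \<open>pf_split_Cons\<close>.\<close>

lemma split_sum_del_sum_right:
  "split_sum u (\<lambda>\<alpha> \<beta>. (-1) ^ length \<alpha> * del_sum \<beta> (\<lambda>y \<beta>'. \<Phi> y \<alpha> \<beta>')) = del_sum u (\<lambda>y v. split_sum v (\<Phi> y))"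
proof (induction u arbitrary: \<Phi>)
  case (Cons z u)
  show ?case
    by (simp add: split_sum_add split_sum_diff Cons.IH[symmetric] del_sum_add algebra_simps split_sum_mult del_sum_mult
      flip: Cons.IH)
qed simp

lemma split_sum_del_sum_swap:
  "split_sum u (\<lambda>\<alpha> \<beta>. del_sum w (\<lambda>y v. \<Phi> y v \<alpha> \<beta>)) = del_sum w (\<lambda>y v. split_sum u (\<Phi> y v))"
  by (induction w arbitrary: \<Phi>) (simp_all add: split_sum_0 split_sum_diff)

subsection \<open>The Pfaffian recursion and the determinant\<close>

text \<open>Expansion along the first letter, taken as the definition on arbitrary words. The
  explicit index sum shows the termination proof that the recursive argument is shorter.\<close>

function pfaffian :: "('b \<Rightarrow> 'b \<Rightarrow> 'a::comm_ring_1) \<Rightarrow> 'b list \<Rightarrow> 'a" where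
  "pfaffian f [] = 1"
| "pfaffian f (x # u) =
    (\<Sum>i<length u. (-1) ^ i * (f x (u ! i) * pfaffian f (take i u @ drop (Suc i) u)))"
  by pat_completeness auto
termination by (relation "measure (\<lambda>(f, u). length u)") auto

declare pfaffian.simps(2) [simp del]

lemma pfaffian_Cons: "pfaffian f (x # u) = del_sum u (\<lambda>y v. f x y * pfaffian f v)"
  by (simp add: pfaffian.simps(2) del_sum_eq_sum)

lemma pfaffian_odd: "odd (length u) \<Longrightarrow> pfaffian f u = 0"
proof (induction u rule: length_induct)
  case (1 u)
  show ?case
  proof (cases u)
    case (Cons x v)
    have "pfaffian f (take i v @ drop (Suc i) v) = 0" if "i < length v" for i
      using that 1 Cons by auto
    then show ?thesis by (simp add: Cons pfaffian.simps(2))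
  qed (use 1 in auto)
qed

text \<open>The double sum of the theorem as one sum over all splittings:
  \<open>length \<alpha> div 2\<close> plays the role of \<open>k\<close>, and parts
  \<open>\<alpha>\<close> of odd length contribute 0 by \<open>pfaffian_odd\<close>.\<close>

definition pf_split :: "('b \<Rightarrow> 'b \<Rightarrow> 'a::comm_ring_1) \<Rightarrow> 'b list \<Rightarrow> 'b list \<Rightarrow> 'a" where
  "pf_split f \<rho> \<sigma> = split_sum \<rho> (\<lambda>\<alpha> \<beta>. (-1) ^ (length \<alpha> div 2) * (pfaffian f \<alpha> * pfaffian f (\<beta> @ \<sigma>)))"

text \<open>If \<open>x\<close> joins \<open>\<alpha>\<close>, its partner lies in
  \<open>\<alpha>\<close>; if it joins \<open>\<beta>\<close>, its partner lies in
  \<open>\<beta>\<close> or in \<open>\<sigma>\<close>. The first two families cancel.\<close>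

lemma pf_split_Cons:
  "pf_split f (x # \<rho>) \<sigma> = (-1) ^ length \<rho> * del_sum \<sigma> (\<lambda>y \<sigma>'. f x y * pf_split f \<rho> \<sigma>')"
proof -
  let ?s = "\<lambda>\<alpha>. (-1) ^ (length \<alpha> div 2)"
  \<comment> \<open>The common term of both families: \<open>x\<close> is paired with
    \<open>y\<close>, and \<open>\<alpha>\<close>, \<open>\<beta>\<close> are what remains of the
    two parts.\<close>
  define \<Phi> where "\<Phi> y \<alpha> \<beta> = ?s \<alpha> * (f x y * (pfaffian f \<alpha> * pfaffian f (\<beta> @ \<sigma>)))" for y \<alpha> \<beta>
  have left: "?s (x # \<alpha>) * (pfaffian f (x # \<alpha>) * pfaffian f (\<beta> @ \<sigma>)) = del_sum \<alpha> (\<lambda>y \<alpha>'. - \<Phi> y \<alpha>' \<beta>)"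
    for \<alpha> \<beta>
  proof -
    have "?s (x # \<alpha>) * (pfaffian f (x # \<alpha>) * pfaffian f (\<beta> @ \<sigma>))
        = del_sum \<alpha> (\<lambda>y \<alpha>'. (?s (x # \<alpha>) * pfaffian f (\<beta> @ \<sigma>)) * (f x y * pfaffian f \<alpha>'))"
      by (simp only: pfaffian_Cons del_sum_mult) (simp only: mult_ac)
    \<comment> \<open>\<open>x # \<alpha>\<close> has two letters more than
      \<open>\<alpha>'\<close>, so \<open>length div 2\<close> grows by exactly 1 for either parity
      and the sign flips.\<close>
    also have "\<dots> = del_sum \<alpha> (\<lambda>y \<alpha>'. - \<Phi> y \<alpha>' \<beta>)"
      by (rule del_sum_cong)
        (auto simp: \<Phi>_def mult_ac dest!: mset_eq_length[where xs = \<alpha> and ys = "_ # _", simplified])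
    finally show ?thesis .
  qed
  have right: "?s \<alpha> * (pfaffian f \<alpha> * pfaffian f (x # \<beta> @ \<sigma>)) = del_sum \<beta> (\<lambda>y \<beta>'. \<Phi> y \<alpha> \<beta>') +
      (-1) ^ length \<beta> * del_sum \<sigma> (\<lambda>y \<sigma>'. f x y * (?s \<alpha> * (pfaffian f \<alpha> * pfaffian f (\<beta> @ \<sigma>'))))" for \<alpha> \<beta>
  proof -
    have "del_sum \<beta> (\<lambda>y \<beta>'. \<Phi> y \<alpha> \<beta>') = (?s \<alpha> * pfaffian f \<alpha>) * del_sum \<beta> (\<lambda>y \<beta>'. f x y * pfaffian f (\<beta>' @ \<sigma>))"
      unfolding del_sum_mult[symmetric] by (rule del_sum_cong) (simp add: \<Phi>_def mult_ac)
    moreover have "del_sum \<sigma> (\<lambda>y \<sigma>'. f x y * (?s \<alpha> * (pfaffian f \<alpha> * pfaffian f (\<beta> @ \<sigma>'))))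
        = (?s \<alpha> * pfaffian f \<alpha>) * del_sum \<sigma> (\<lambda>y \<sigma>'. f x y * pfaffian f (\<beta> @ \<sigma>'))"
      unfolding del_sum_mult[symmetric] by (rule del_sum_cong) (simp add: mult_ac)
    ultimately show ?thesis
      by (simp add: pfaffian_Cons del_sum_append algebra_simps)
  qed
  have "pf_split f (x # \<rho>) \<sigma> = split_sum \<rho> (\<lambda>\<alpha> \<beta>. del_sum \<alpha> (\<lambda>y \<alpha>'. - \<Phi> y \<alpha>' \<beta>)) +
      split_sum \<rho> (\<lambda>\<alpha> \<beta>. (-1) ^ length \<alpha> * del_sum \<beta> (\<lambda>y \<beta>'. \<Phi> y \<alpha> \<beta>')) +
      split_sum \<rho> (\<lambda>\<alpha> \<beta>. (-1) ^ length \<alpha> * ((-1) ^ length \<beta> *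
        del_sum \<sigma> (\<lambda>y \<sigma>'. f x y * (?s \<alpha> * (pfaffian f \<alpha> * pfaffian f (\<beta> @ \<sigma>'))))))"
    unfolding pf_split_def split_sum.simps append_Cons left right
    by (simp only: distrib_left split_sum_add add.assoc)
  \<comment> \<open>Both exchange rules lead to the same \<open>del_sum\<close> over
    \<open>\<rho>\<close>.\<close>
  also have "split_sum \<rho> (\<lambda>\<alpha> \<beta>. del_sum \<alpha> (\<lambda>y \<alpha>'. - \<Phi> y \<alpha>' \<beta>)) =
      - split_sum \<rho> (\<lambda>\<alpha> \<beta>. (-1) ^ length \<alpha> * del_sum \<beta> (\<lambda>y \<beta>'. \<Phi> y \<alpha> \<beta>'))"
    unfolding split_sum_del_sum_right
    by (simp add: del_sum_uminus split_sum_uminus split_sum_del_sum_left)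
  \<comment> \<open>One sign comes from \<open>x\<close> passing \<open>\<alpha>\<close>, the other
    from its partner in \<open>\<sigma>\<close> passing \<open>\<beta>\<close>; the lengths add up
    to that of \<open>\<rho>\<close>.\<close>
  also have "split_sum \<rho> (\<lambda>\<alpha> \<beta>. (-1) ^ length \<alpha> * ((-1) ^ length \<beta> *
        del_sum \<sigma> (\<lambda>y \<sigma>'. f x y * (?s \<alpha> * (pfaffian f \<alpha> * pfaffian f (\<beta> @ \<sigma>'))))))
      = split_sum \<rho> (\<lambda>\<alpha> \<beta>. (-1) ^ length \<rho> *
        del_sum \<sigma> (\<lambda>y \<sigma>'. f x y * (?s \<alpha> * (pfaffian f \<alpha> * pfaffian f (\<beta> @ \<sigma>')))))"
    by (rule split_sum_cong)
      (auto simp: power_add dest!: mset_eq_length[where xs = \<rho> and ys = "_ @ _", simplified])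
  also have "\<dots> = (-1) ^ length \<rho> * del_sum \<sigma> (\<lambda>y \<sigma>'. f x y * pf_split f \<rho> \<sigma>')"
    by (simp add: split_sum_mult split_sum_del_sum_swap pf_split_def)
  finally show ?thesis by simp
qed

text \<open>Rows and columns are labelled by words, so that deleting a row or column is deleting a
  letter.\<close>

definition minor_of :: "('b \<Rightarrow> 'b \<Rightarrow> 'a) \<Rightarrow> 'b list \<Rightarrow> 'b list \<Rightarrow> 'a mat" where
  "minor_of f \<rho> \<sigma> = mat (length \<rho>) (length \<sigma>) (\<lambda>(i, j). f (\<rho> ! i) (\<sigma> ! j))"

lemma det_minor_of_Cons:
  assumes "length \<sigma> = Suc (length \<rho>)"
  shows "det (minor_of f (x # \<rho>) \<sigma>) = del_sum \<sigma> (\<lambda>y \<sigma>'. f x y * det (minor_of f \<rho> \<sigma>'))"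
proof -
  let ?A = "minor_of f (x # \<rho>) \<sigma>"
  have A: "?A \<in> carrier_mat (length \<sigma>) (length \<sigma>)"
    using assms by (simp add: minor_of_def)
  have "mat_delete ?A 0 j = minor_of f \<rho> (take j \<sigma> @ drop (Suc j) \<sigma>)" if "j < length \<sigma>" for j
    using that assms by (intro eq_matI) (auto simp: mat_delete_def minor_of_def nth_append)
  moreover have "?A $$ (0, j) = f x (\<sigma> ! j)" if "j < length \<sigma>" for j
    using that by (simp add: minor_of_def)
  ultimately show ?thesis
    using assms
    by (subst laplace_expansion_row[OF A, of 0])
       (auto simp: del_sum_eq_sum cofactor_def mult_ac intro!: sum.cong)
qed

text \<open>By \<open>pf_split_Cons\<close> and \<open>det_minor_of_Cons\<close> both sides obey the
  same recursion up to sign. The induction is over all \<open>\<sigma>\<close> because the recursion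
  takes an arbitrary letter out of it.\<close>

lemma pf_split_eq_det:
  fixes f :: "'b \<Rightarrow> 'b \<Rightarrow> 'a::comm_ring_1"
  assumes "length \<sigma> = length \<rho>"
  shows "pf_split f \<rho> \<sigma> = (-1) ^ (length \<rho> div 2) * det (minor_of f \<rho> \<sigma>)"
  using assms
proof (induction \<rho> arbitrary: \<sigma>)
  case Nil
  then show ?case by (simp add: pf_split_def minor_of_def det_dim_zero)
next
  case (Cons x \<rho>)
  have "del_sum \<sigma> (\<lambda>y \<sigma>'. f x y * pf_split f \<rho> \<sigma>')
      = del_sum \<sigma> (\<lambda>y \<sigma>'. (-1) ^ (length \<rho> div 2) * (f x y * det (minor_of f \<rho> \<sigma>')))"
  proof (rule del_sum_cong)
    fix y \<sigma>' assume "mset \<sigma> = add_mset y (mset \<sigma>')"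
    then have "length \<sigma>' = length \<rho>"
      using Cons.prems mset_eq_length[of \<sigma> "y # \<sigma>'"] by simp
    then show "f x y * pf_split f \<rho> \<sigma>' = (-1) ^ (length \<rho> div 2) * (f x y * det (minor_of f \<rho> \<sigma>'))"
      by (simp add: Cons.IH)
  qed
  then have "pf_split f (x # \<rho>) \<sigma>
      = ((-1) ^ length \<rho> * (-1) ^ (length \<rho> div 2)) * det (minor_of f (x # \<rho>) \<sigma>)"
    using Cons.prems by (simp only: pf_split_Cons del_sum_mult det_minor_of_Cons list.size mult.assoc)
  \<comment> \<open>With \<open>l = length \<rho>\<close>, the number \<open>l + l div 2\<close> has
    the parity of \<open>(l + 1) div 2\<close>.\<close>
  moreover have "(-1) ^ length \<rho> * (-1) ^ (length \<rho> div 2) = ((-1) ^ (length (x # \<rho>) div 2) :: 'a)"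
    by (cases "even (length \<rho>)") (auto elim!: evenE oddE)
  ultimately show ?case by simp
qed

subsection \<open>Words with repeated letters\<close>

text \<open>The vanishing part is not a consequence of the antisymmetry, since \<open>2\<close> may be a zero divisor.\<close>

lemma pfaffian_adjacent:
  assumes diag: "\<And>x. f x x = 0" and anti: "\<And>x y. f y x = - f x y"
  shows "pfaffian f (a @ x # x # b) = 0 \<and> pfaffian f (a @ x # y # b) = - pfaffian f (a @ y # x # b)"
\<comment> \<open>Length induction, because expanding along the first letter of \<open>a\<close>
  deletes an arbitrary letter of its tail.\<close>
proof (induction a arbitrary: b rule: length_induct)
  case (1 a)
  show ?case
  proof (cases a)
    case Nil
    have expand: "pfaffian f (x # y # b) = f x y * pfaffian f b -
        del_sum b (\<lambda>z v. del_sum v (\<lambda>z' w. f x z * (f y z' * pfaffian f w)))" for x y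
      by (simp only: pfaffian_Cons del_sum.simps del_sum_mult)
    \<comment> \<open>With equal letters the integrand is symmetric in \<open>z\<close> and
      \<open>z'\<close>; together with \<open>f x x = 0\<close> this gives the first claim.\<close>
    have square: "del_sum b (\<lambda>z v. del_sum v (\<lambda>z' w. f x z * (f x z' * pfaffian f w))) = 0"
      by (rule del_sum_del_sum_symmetric) (simp add: mult_ac)
    \<comment> \<open>The sum over both orders of \<open>x\<close> and \<open>y\<close> is again
      symmetric in \<open>z\<close> and \<open>z'\<close>, so exchanging \<open>x\<close> and
      \<open>y\<close> changes the sign.\<close>
    have "del_sum b (\<lambda>z v. del_sum v (\<lambda>z' w. f x z * (f y z' * pfaffian f w) + f y z * (f x z' * pfaffian f w))) = 0"
      by (rule del_sum_del_sum_symmetric) (simp add: mult_ac)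
    then have "del_sum b (\<lambda>z v. del_sum v (\<lambda>z' w. f x z * (f y z' * pfaffian f w)))
        = - del_sum b (\<lambda>z v. del_sum v (\<lambda>z' w. f y z * (f x z' * pfaffian f w)))"
      by (simp add: del_sum_add eq_neg_iff_add_eq_0)
    then show ?thesis
      using square anti[of x y] by (simp add: Nil expand diag)
  next
    case (Cons h a')
    \<comment> \<open>The terms pairing \<open>h\<close> with \<open>x\<close> and with
      \<open>y\<close> trade places with opposite signs under the exchange of \<open>x\<close> and
      \<open>y\<close>, and cancel for \<open>x = y\<close>. The other terms fall to the induction
      hypothesis.\<close>
    have expand: "pfaffian f (a @ x # y # b) = del_sum a' (\<lambda>z v. f h z * pfaffian f (v @ x # y # b)) +
        (-1) ^ length a' * (f h x * pfaffian f (a' @ y # b) - (f h y * pfaffian f (a' @ x # b) -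
          del_sum b (\<lambda>z v. f h z * pfaffian f (a' @ x # y # v))))" for x y
      by (simp only: Cons append_Cons pfaffian_Cons del_sum_append del_sum.simps)
    have IH: "pfaffian f (a' @ x # x # v) = 0" "pfaffian f (a' @ x # y # v) = - pfaffian f (a' @ y # x # v)" for v
      using 1 Cons by auto
    have IH': "pfaffian f (v @ x # x # b) = 0" "pfaffian f (v @ x # y # b) = - pfaffian f (v @ y # x # b)"
      if "mset a' = add_mset z (mset v)" for z v
      using 1 Cons mset_eq_length[of a' "z # v"] that by auto
    have "del_sum a' (\<lambda>z v. f h z * pfaffian f (v @ x # x # b)) = del_sum a' (\<lambda>z v. 0)"
      by (rule del_sum_cong) (simp add: IH')
    moreover have "del_sum a' (\<lambda>z v. f h z * pfaffian f (v @ x # y # b))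
        = - del_sum a' (\<lambda>z v. f h z * pfaffian f (v @ y # x # b))"
      unfolding del_sum_uminus[symmetric] by (rule del_sum_cong) (simp add: IH')
    ultimately show ?thesis
      by (simp add: expand IH del_sum_uminus del_sum_0 algebra_simps)
  qed
qed

text \<open>The first of two equal letters moves right by adjacent swaps, each costing a sign, until
  it meets the second one; the prefix absorbs the letters passed.\<close>

lemma pfaffian_not_distinct:
  assumes diag: "\<And>x. f x x = 0" and anti: "\<And>x y. f y x = - f x y"
    and "\<not> distinct w"
  shows "pfaffian f w = 0"
proof -
  have "pfaffian f (a @ x # b @ x # c) = 0" for a b c x
  proof (induction b arbitrary: a)
    case Nil
    then show ?case using pfaffian_adjacent[of f a x c x, OF diag anti] by simp
  next
    case (Cons y b)
    have "pfaffian f (a @ x # y # b @ x # c) = - pfaffian f ((a @ [y]) @ x # b @ x # c)"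
      using pfaffian_adjacent[of f a x "b @ x # c" y, OF diag anti] by simp
    then show ?case using Cons[of "a @ [y]"] by simp
  qed
  then show ?thesis
    using not_distinct_decomp[OF assms(3)] by auto
qed

subsection \<open>Splittings of words with distinct letters\<close>

lemma mset_append_word_minus:
  assumes "distinct \<rho>" "subseq \<omega> \<rho>"
  shows "mset (\<omega> @ word_minus \<rho> \<omega>) = mset \<rho>"
proof -
  have "distinct \<omega>" using assms by (auto intro: subseqs_distinctD)
  moreover have "set \<omega> \<subseteq> set \<rho>" using assms(2) by (auto dest: list_emb_set)
  ultimately show ?thesis
    using assms(1) by (intro set_eq_iff_mset_eq_distinct[THEN iffD1]) (auto simp: word_minus_def)
qed

lemma finite_subseq: "finite {\<omega>. subseq \<omega> \<rho>}"
  by (simp flip: set_subseqs_eq)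

text \<open>For distinct letters a splitting is determined by its left part. The sign built into the
  recursion is the one in the theorem: a letter put into the right part passes the whole left
  part.\<close>

lemma split_sum_eq_sum:
  assumes "distinct \<rho>"
  shows "split_sum \<rho> \<Phi> = (\<Sum>\<omega> | subseq \<omega> \<rho>.
    of_int (word_sgn \<rho> (\<omega> @ word_minus \<rho> \<omega>)) * \<Phi> \<omega> (word_minus \<rho> \<omega>))"
  using assms
proof (induction \<rho> arbitrary: \<Phi>)
  case Nil
  have "{\<omega>. subseq \<omega> []} = {[] :: 'a list}" by auto
  then show ?case by (simp add: word_minus_def word_sgn_self)
next
  case (Cons x u)
  let ?S = "{\<omega>. subseq \<omega> u}"
  let ?g = "\<lambda>\<omega>. of_int (word_sgn (x # u) (\<omega> @ word_minus (x # u) \<omega>)) * \<Phi> \<omega> (word_minus (x # u) \<omega>)"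
  have S: "{\<omega>. subseq \<omega> (x # u)} = Cons x ` ?S \<union> ?S"
    by (simp flip: set_subseqs_eq add: Let_def)
  have notin: "x \<notin> set \<omega>" if "subseq \<omega> u" for \<omega>
    using that Cons.prems by (auto dest: list_emb_set)
  have with_x: "?g (x # \<omega>) = of_int (word_sgn u (\<omega> @ word_minus u \<omega>)) * \<Phi> (x # \<omega>) (word_minus u \<omega>)"
    if "subseq \<omega> u" for \<omega>
  proof -
    have "word_minus (x # u) (x # \<omega>) = word_minus u \<omega>"
      using Cons.prems by (auto simp: word_minus_def intro!: filter_cong)
    moreover have "word_sgn (x # u) (x # \<omega> @ word_minus u \<omega>) = word_sgn u (\<omega> @ word_minus u \<omega>)"
      using Cons.prems that by (intro word_sgn_Cons mset_append_word_minus) auto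
    ultimately show ?thesis by simp
  qed
  have without_x: "?g \<omega> = of_int (word_sgn u (\<omega> @ word_minus u \<omega>)) *
      ((-1) ^ length \<omega> * \<Phi> \<omega> (x # word_minus u \<omega>))" if "subseq \<omega> u" for \<omega>
  proof -
    let ?v = "word_minus u \<omega>"
    have wm: "word_minus (x # u) \<omega> = x # ?v"
      using notin[OF that] by (simp add: word_minus_def)
    have m: "mset (\<omega> @ ?v) = mset u"
      using Cons.prems that by (intro mset_append_word_minus) auto
    have d: "distinct (\<omega> @ x # ?v)"
      using Cons.prems m mset_eq_imp_distinct_iff[of "\<omega> @ x # ?v" "x # u"] by simp
    \<comment> \<open>First the tail is rearranged behind \<open>x\<close>, then \<open>x\<close>
      passes \<open>\<omega>\<close>.\<close>
    have "word_sgn (x # u) (\<omega> @ x # ?v)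
        = word_sgn (x # u) (x # \<omega> @ ?v) * word_sgn (x # \<omega> @ ?v) (\<omega> @ x # ?v)"
      using Cons.prems m by (intro word_sgn_trans) auto
    also have "word_sgn (x # u) (x # \<omega> @ ?v) = word_sgn u (\<omega> @ ?v)"
      using Cons.prems m by (intro word_sgn_Cons) auto
    also have "word_sgn (x # \<omega> @ ?v) (\<omega> @ x # ?v) = (-1) ^ length \<omega>"
      using word_sgn_sym[of "\<omega> @ x # ?v" "x # \<omega> @ ?v"] word_sgn_move[OF d] d by simp
    finally show ?thesis by (simp add: wm)
  qed
  have "split_sum (x # u) \<Phi> = (\<Sum>\<omega>\<in>?S. ?g (x # \<omega>)) + (\<Sum>\<omega>\<in>?S. ?g \<omega>)"
  proof -
    have "(\<Sum>\<omega>\<in>?S. ?g (x # \<omega>)) = (\<Sum>\<omega>\<in>?S. of_int (word_sgn u (\<omega> @ word_minus u \<omega>)) *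
        \<Phi> (x # \<omega>) (word_minus u \<omega>))"
      by (intro sum.cong refl with_x) simp
    moreover have "(\<Sum>\<omega>\<in>?S. ?g \<omega>) = (\<Sum>\<omega>\<in>?S. of_int (word_sgn u (\<omega> @ word_minus u \<omega>)) *
        ((-1) ^ length \<omega> * \<Phi> \<omega> (x # word_minus u \<omega>)))"
      by (intro sum.cong refl without_x) simp
    ultimately show ?thesis
      using Cons by (simp add: distrib_left sum.distrib)
  qed
  also have "(\<Sum>\<omega>\<in>?S. ?g (x # \<omega>)) = (\<Sum>\<omega>\<in>Cons x ` ?S. ?g \<omega>)"
    by (simp add: sum.reindex)
  also have "\<dots> + (\<Sum>\<omega>\<in>?S. ?g \<omega>) = (\<Sum>\<omega>\<in>Cons x ` ?S \<union> ?S. ?g \<omega>)"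
    by (intro sum.union_disjoint[symmetric]) (auto simp: finite_subseq dest: notin)
  finally show ?case unfolding S .
qed

subsection \<open>Pair partitions and the Pfaffian recursion\<close>

text \<open>With \<open>pair_prod\<close>, a recursive form of the indexed set and product in
  \<open>lists_pairs\<close> and \<open>pf_term\<close>, suited to induction in steps of two. A
  leftover last letter is ignored.\<close>

fun pairs :: "'b list \<Rightarrow> 'b set set" where
  "pairs (x # y # u) = insert {x, y} (pairs u)"
| "pairs _ = {}"

fun pair_prod :: "('b \<Rightarrow> 'b \<Rightarrow> 'a::comm_ring_1) \<Rightarrow> 'b list \<Rightarrow> 'a" where
  "pair_prod f (x # y # u) = f x y * pair_prod f u"
| "pair_prod f _ = 1"

lemma pairs_eq: "pairs js = (\<lambda>i. {js ! (2 * i), js ! (2 * i + 1)}) ` {..<length js div 2}"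
  by (induction js rule: pairs.induct) (simp_all add: lessThan_Suc_eq_insert_0 image_image)

lemma pair_prod_eq: "pair_prod f js = (\<Prod>i<length js div 2. f (js ! (2 * i)) (js ! (2 * i + 1)))"
  by (induction js rule: pairs.induct) (simp_all add: prod.lessThan_Suc_shift del: prod.lessThan_Suc)

lemma lists_pairs_iff: "lists_pairs js M \<longleftrightarrow> distinct js \<and> even (length js) \<and> M = pairs js"
  by (simp add: lists_pairs_def pairs_eq)

lemma Union_pairs: "even (length js) \<Longrightarrow> \<Union>(pairs js) = set js"
  by (induction js rule: pairs.induct) auto

text \<open>Moving a block past another block is an even permutation. If \<open>x\<close> is the
  second letter of its block, the sign of the swap is offset by the antisymmetry of
  \<open>f\<close>.\<close>

lemma pull_pair:
  fixes f :: "'b \<Rightarrow> 'b \<Rightarrow> 'a::comm_ring_1"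
  assumes anti: "\<And>x y. f y x = - f x y"
    and "distinct js" "even (length js)" "x \<in> set js"
  shows "\<exists>y r. mset (x # y # r) = mset js \<and> pairs js = insert {x, y} (pairs r) \<and>
    pair_prod f js = of_int (word_sgn js (x # y # r)) * pair_prod f (x # y # r)"
  using assms(2-)
proof (induction js rule: pairs.induct)
  case (1 a b u)
  consider "x = a" | "x = b" | "x \<in> set u" using 1 by auto
  then show ?case
  proof cases
    assume "x = a"
    then show ?thesis using 1
      by (intro exI[of _ b] exI[of _ u]) (simp add: word_sgn_self)
  next
    assume "x = b"
    then show ?thesis using 1 anti[of a b]
      by (intro exI[of _ a] exI[of _ u]) (auto simp: word_sgn_swap)
  next
    assume "x \<in> set u"
    then obtain y r where r: "mset (x # y # r) = mset u" "pairs u = insert {x, y} (pairs r)"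
      "pair_prod f u = of_int (word_sgn u (x # y # r)) * pair_prod f (x # y # r)"
      using 1 by auto
    have d: "distinct (a # b # x # y # r)"
      using 1 r(1) mset_eq_imp_distinct_iff[of "a # b # x # y # r" "a # b # u"] by simp
    have m: "mset (x # y # a # b # r) = mset (a # b # u)"
      by (simp add: add_mset_commute flip: r(1))
    have "word_sgn (a # b # u) (x # y # a # b # r)
        = word_sgn (a # b # u) (a # b # x # y # r) * word_sgn (a # b # x # y # r) (x # y # a # b # r)"
      using 1(2) r(1) m by (intro word_sgn_trans) simp_all
    also have "word_sgn (a # b # u) (a # b # x # y # r) = word_sgn u (x # y # r)"
      using 1 r(1) by (simp add: word_sgn_Cons)
    \<comment> \<open>First \<open>x\<close> and then \<open>y\<close> passes the two letters
      \<open>a\<close>, \<open>b\<close>, each with sign \<open>(-1) ^ 2\<close>.\<close>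
    also have "word_sgn (a # b # x # y # r) (x # y # a # b # r)
        = word_sgn (a # b # x # y # r) (x # a # b # y # r) * word_sgn (x # a # b # y # r) (x # y # a # b # r)"
      using d by (intro word_sgn_trans) auto
    also have "\<dots> = 1"
      using word_sgn_move[of "[a, b]" x "y # r"] word_sgn_move[of "[a, b]" y r] d
        word_sgn_Cons[of x "a # b # y # r" "y # a # b # r"]
      by (auto simp: add_mset_commute)
    finally have "word_sgn (a # b # u) (x # y # a # b # r) = word_sgn u (x # y # r)" by simp
    moreover have "pairs (a # b # u) = insert {x, y} (pairs (a # b # r))"
      using r(2) by auto
    ultimately show ?thesis using r(3) m
      by (intro exI[of _ y] exI[of _ "a # b # r"]) (simp add: mult_ac)
  qed
qed auto

text \<open>This makes the summand of the Pfaffian independent of the listing. The block of the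
  first letter is pulled to the front of \<open>ks\<close> and removed from both listings.\<close>

lemma pair_prod_listing:
  fixes f :: "'b \<Rightarrow> 'b \<Rightarrow> 'a::comm_ring_1"
  assumes anti: "\<And>x y. f y x = - f x y"
    and "lists_pairs js M" "lists_pairs ks M"
  shows "pair_prod f js = of_int (word_sgn js ks) * pair_prod f ks"
  using assms(2-)
proof (induction js arbitrary: ks M rule: pairs.induct)
  case (1 a b u)
  then have js: "distinct (a # b # u)" "even (length u)" "M = insert {a, b} (pairs u)"
    and ks: "distinct ks" "even (length ks)" "M = pairs ks"
    by (auto simp: lists_pairs_iff)
  have "set ks = set (a # b # u)"
    using Union_pairs[OF ks(2)] Union_pairs[OF js(2)] js ks by auto
  then obtain y r where r: "mset (a # y # r) = mset ks" "pairs ks = insert {a, y} (pairs r)"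
      "pair_prod f ks = of_int (word_sgn ks (a # y # r)) * pair_prod f (a # y # r)"
    using pull_pair[of f ks a, OF anti ks(1,2)] by auto
  have dr: "distinct (a # y # r)" using r(1) ks(1) by (metis mset_eq_imp_distinct_iff)
  have "length ks = length (a # y # r)" using r(1) by (metis mset_eq_length)
  then have er: "even (length r)" using ks(2) by simp
  have notin: "B \<notin> pairs u" "B \<notin> pairs r" if "a \<in> B" for B
    using Union_pairs[OF js(2)] Union_pairs[OF er] js(1) dr that by auto
  \<comment> \<open>No block of \<open>pairs r\<close> contains \<open>a\<close>, so the partner of
    \<open>a\<close> in \<open>ks\<close> must be \<open>b\<close>.\<close>
  have "{a, b} \<in> insert {a, y} (pairs r)" using js(3) ks(3) r(2) by auto
  then have "y = b" using notin(2)[of "{a, b}"] js(1) by (auto simp: doubleton_eq_iff)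
  moreover have "pairs u = pairs r"
    using js(3) ks(3) r(2) notin[of "{a, b}"] \<open>y = b\<close>
      insert_ident[of "{a, b}" "pairs u" "pairs r"] by simp
  ultimately have IH: "pair_prod f u = of_int (word_sgn u r) * pair_prod f r"
    using js dr er by (intro 1(1)) (auto simp: lists_pairs_iff)
  have mset_u: "mset r = mset u"
    using set_eq_iff_mset_eq_distinct[OF ks(1) js(1)] \<open>set ks = _\<close> r(1) \<open>y = b\<close> by simp
  have "word_sgn (a # b # u) ks = word_sgn (a # b # u) (a # b # r) * word_sgn (a # b # r) ks"
    using js(1) r(1) mset_u \<open>y = b\<close> by (intro word_sgn_trans) auto
  moreover have "word_sgn (a # b # u) (a # b # r) = word_sgn u r"
    using js(1) mset_u by (simp add: word_sgn_Cons)
  moreover have "word_sgn (a # b # r) ks = word_sgn ks (a # b # r)"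
    using ks(1) r(1) \<open>y = b\<close> by (intro word_sgn_sym) auto
  \<comment> \<open>This sign occurs twice: in \<open>word_sgn (a # b # u) ks\<close> and in
    \<open>pair_prod f ks\<close>.\<close>
  moreover have "of_int (word_sgn ks (a # b # r)) * of_int (word_sgn ks (a # b # r)) = (1 :: 'a)"
    by (simp add: word_sgn_def flip: of_int_mult)
  ultimately show ?case using r(3) \<open>y = b\<close> IH by (simp add: algebra_simps)
next
  case "2_1"
  then have "ks = []" using Union_pairs[of ks] by (auto simp: lists_pairs_iff)
  then show ?case by (simp add: word_sgn_self)
qed (auto simp: lists_pairs_iff)

text \<open>Peeling off one block at a time turns a partition into a listing, through which
  partitions are handled from here on.\<close>

lemma pair_partitions_eq:
  assumes "finite X"
  shows "pair_partitions X = {pairs js | js. distinct js \<and> even (length js) \<and> set js = X}"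
proof (intro equalityI subsetI)
  fix M assume "M \<in> pair_partitions X"
  with assms have "\<exists>js. M = pairs js \<and> distinct js \<and> even (length js) \<and> set js = X"
  proof (induction X arbitrary: M rule: finite_psubset_induct)
    case (psubset X)
    show ?case
    proof (cases "X = {}")
      case True
      then have "M = {}" using psubset.prems by (auto simp: pair_partitions_def partition_on_def)
      then show ?thesis using True by (intro exI[of _ "[]"]) auto
    next
      case False
      have M: "\<Union>M = X" "disjoint M" "{} \<notin> M" "\<And>B. B \<in> M \<Longrightarrow> card B = 2"
        using psubset.prems by (auto simp: pair_partitions_def partition_on_def)
      obtain B where B: "B \<in> M" using False M(1) by auto
      then obtain x y where xy: "B = {x, y}" "x \<noteq> y"
        using M(4)[OF B] by (auto simp: card_2_iff)
      have disj: "C \<inter> B = {}" if "C \<in> M - {B}" for C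
        using M(2) B that by (auto simp: disjoint_def)
      have "\<Union>(M - {B}) = X - B" using M(1) B disj by blast
      then have "M - {B} \<in> pair_partitions (X - B)"
        using M by (auto simp: pair_partitions_def partition_on_def disjoint_def)
      moreover have "X - B \<subset> X" using B M(1) xy by auto
      ultimately obtain r where r: "M - {B} = pairs r" "distinct r" "even (length r)" "set r = X - B"
        using psubset.IH by blast
      show ?thesis
        using r xy B M(1) by (intro exI[of _ "x # y # r"]) auto
    qed
  qed
  then show "M \<in> {pairs js | js. distinct js \<and> even (length js) \<and> set js = X}" by blast
next
  fix M assume "M \<in> {pairs js | js. distinct js \<and> even (length js) \<and> set js = X}"
  then obtain js where "M = pairs js" "distinct js" "even (length js)" "set js = X" by blast
  then show "M \<in> pair_partitions X"
  proof (induction js arbitrary: M X rule: pairs.induct)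
    case (1 x y u)
    then have "pairs u \<in> pair_partitions (set u)" "\<Union>(pairs u) = set u"
      by (auto simp: Union_pairs)
    with 1 show ?case
      by (auto simp: pair_partitions_def partition_on_def disjoint_def)
  qed (auto simp: pair_partitions_def partition_on_def)
qed

text \<open>By \<open>pair_prod_listing\<close> the choice made by \<open>SOME\<close> does not
  matter. Agreement of \<open>f\<close> and \<open>T\<close> is asked on the letters of
  \<open>w\<close> because entries outside a matrix are unspecified.\<close>

lemma pf_term_listing:
  assumes anti: "\<And>x y. f y x = - f x y"
    and T: "\<And>x y. x \<in> set w \<Longrightarrow> y \<in> set w \<Longrightarrow> T $$ (x, y) = f x y"
    and "distinct w" "lists_pairs ks M" "set ks = set w"
  shows "pf_term T w M = of_int (word_sgn w ks) * pair_prod f ks"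
proof -
  define js where "js = (SOME js. lists_pairs js M)"
  have js: "lists_pairs js M"
    unfolding js_def using assms(4) by (rule someI)
  have set_js: "set js = set w"
    using js assms(4,5) Union_pairs[of js] Union_pairs[of ks] by (auto simp: lists_pairs_iff)
  then have m: "mset js = mset w" "mset ks = mset w"
    using js assms(3-5) by (auto simp: lists_pairs_iff set_eq_iff_mset_eq_distinct[symmetric])
  have "pf_term T w M = of_int (word_sgn w js) * pair_prod f js"
    unfolding pf_term_def Let_def js_def[symmetric] pair_prod_eq
    by (intro arg_cong2[of _ _ _ _ "(*)"] prod.cong T) (auto simp flip: set_js)
  also have "\<dots> = of_int (word_sgn w js * word_sgn js ks) * pair_prod f ks"
    by (simp add: pair_prod_listing[of f, OF anti js assms(4)] mult_ac)
  also have "word_sgn w js * word_sgn js ks = word_sgn w ks"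
    using assms(3) m by (intro word_sgn_trans[symmetric]) auto
  finally show ?thesis .
qed

text \<open>The pair partitions are sorted by the partner \<open>u ! i\<close> of \<open>x\<close>;
  \<open>?h\<close> restores the block of \<open>x\<close> to a partition of the remaining letters
  and is a bijection.\<close>

lemma pf_Cons:
  assumes anti: "\<And>x y. f y x = - f x y"
    and T: "\<And>a b. a \<in> set (x # u) \<Longrightarrow> b \<in> set (x # u) \<Longrightarrow> T $$ (a, b) = f a b"
    and d: "distinct (x # u)" and odd: "odd (length u)"
  shows "pf T (x # u) =
    (\<Sum>i<length u. (-1) ^ i * (f x (u ! i) * pf T (take i u @ drop (Suc i) u)))"
proof -
  let ?d = "\<lambda>i. take i u @ drop (Suc i) u"
  let ?P = "\<lambda>i. pair_partitions (set (?d i))"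
  let ?h = "\<lambda>(i, M). insert {x, u ! i} M"
  have u: "u = take i u @ u ! i # drop (Suc i) u" if "i < length u" for i
    using that by (rule id_take_nth_drop)
  have mset_d: "mset (u ! i # ?d i) = mset u" if "i < length u" for i
    by (subst (4) u[OF that]) simp
  have dist_d: "distinct (u ! i # ?d i)" if "i < length u" for i
    using d mset_d[OF that] by (metis distinct.simps(2) mset_eq_imp_distinct_iff)
  have set_d: "set u = insert (u ! i) (set (?d i))" if "i < length u" for i
    using mset_eq_setD[OF mset_d[OF that]] by simp
  have not_x: "x \<notin> B" if "i < length u" "M \<in> ?P i" "B \<in> M" for i M B
    using that d set_d[OF that(1)] by (auto simp: pair_partitions_def partition_on_def)
  have inj: "inj_on ?h (SIGMA i:{..<length u}. ?P i)"
  proof (rule inj_onI)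
    fix p q assume pq: "p \<in> (SIGMA i:{..<length u}. ?P i)" "q \<in> (SIGMA i:{..<length u}. ?P i)"
      "?h p = ?h q"
    obtain i M i' M' where eq: "p = (i, M)" "q = (i', M')" by (cases p, cases q)
    with pq have *: "i < length u" "M \<in> ?P i" "i' < length u" "M' \<in> ?P i'"
      "insert {x, u ! i} M = insert {x, u ! i'} M'"
      by auto
    \<comment> \<open>No block of \<open>M\<close> or \<open>M'\<close> contains \<open>x\<close>,
      so the block of \<open>x\<close> determines the partner, and removing it recovers the
      rest.\<close>
    then have n: "{x, u ! i} \<notin> M" "{x, u ! i'} \<notin> M'" "{x, u ! i} \<notin> M'"
      using not_x by blast+
    then have "{x, u ! i} = {x, u ! i'}" using * by blast
    then have "u ! i = u ! i'" by (auto simp: doubleton_eq_iff)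
    then have "i = i'" using * d by (simp add: nth_eq_iff_index_eq)
    moreover have "M = M'"
      using * n \<open>i = i'\<close> insert_ident[of "{x, u ! i}" M M'] by simp
    ultimately show "p = q" by (simp add: eq)
  qed
  have img: "?h ` (SIGMA i:{..<length u}. ?P i) = pair_partitions (set (x # u))"
  proof (intro equalityI subsetI)
    fix M assume "M \<in> ?h ` (SIGMA i:{..<length u}. ?P i)"
    then obtain i N where i: "i < length u" "N \<in> ?P i" "M = insert {x, u ! i} N" by auto
    then obtain r where r: "N = pairs r" "distinct r" "even (length r)" "set r = set (?d i)"
      by (auto simp: pair_partitions_eq)
    then show "M \<in> pair_partitions (set (x # u))"
      using i d dist_d[OF i(1)] set_d[OF i(1)]
      by (auto simp: pair_partitions_eq intro!: exI[of _ "x # u ! i # r"])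
  next
    fix M assume "M \<in> pair_partitions (set (x # u))"
    then obtain js where js: "M = pairs js" "distinct js" "even (length js)" "set js = set (x # u)"
      by (subst (asm) pair_partitions_eq) auto
    then obtain y r where r: "mset (x # y # r) = mset js" "pairs js = insert {x, y} (pairs r)"
      using pull_pair[of f js x, OF anti] by auto
    have "distinct (x # y # r)" using r(1) js(2) by (metis mset_eq_imp_distinct_iff)
    moreover have "set (x # y # r) = set (x # u)" using r(1) js(4) by (metis mset_eq_setD)
    moreover have "length js = length (x # y # r)" using r(1) by (metis mset_eq_length)
    ultimately have *: "distinct (y # r)" "set u = insert y (set r)" "even (length r)"
      using d js(3) by (simp_all add: insert_ident)
    then obtain i where i: "i < length u" "u ! i = y" by (metis in_set_conv_nth insertI1)
    have "set r = set (?d i)"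
      using set_d[OF i(1)] dist_d[OF i(1)] * i(2) insert_ident[of y "set r" "set (?d i)"] by simp
    then have "pairs r \<in> ?P i" using * by (auto simp: pair_partitions_eq)
    then show "M \<in> ?h ` (SIGMA i:{..<length u}. ?P i)"
      using i r(2) js(1) by (auto intro!: image_eqI[of _ _ "(i, pairs r)"])
  qed
  have term_eq: "pf_term T (x # u) (?h (i, M)) = (-1) ^ i * (f x (u ! i) * pf_term T (?d i) M)"
    if i: "i < length u" and M: "M \<in> ?P i" for i M
  proof -
    obtain r where r: "M = pairs r" "distinct r" "even (length r)" "set r = set (?d i)"
      using M by (auto simp: pair_partitions_eq)
    then have "mset r = mset (?d i)"
      using dist_d[OF i] set_eq_iff_mset_eq_distinct[of r "?d i"] by simp
    have "pf_term T (x # u) (?h (i, M))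
        = of_int (word_sgn (x # u) (x # u ! i # r)) * pair_prod f (x # u ! i # r)"
      using T d r dist_d[OF i] set_d[OF i] i
      by (intro pf_term_listing[OF anti]) (auto simp: lists_pairs_iff)
    also have "word_sgn (x # u) (x # u ! i # r) = word_sgn u (u ! i # r)"
      using d mset_d[OF i] \<open>mset r = _\<close> by (intro word_sgn_Cons) auto
    \<comment> \<open>Moving \<open>u ! i\<close> to the front of \<open>u\<close> gives
      \<open>(-1) ^ i\<close>; the other factor is the sign for the remaining word.\<close>
    also have "\<dots> = word_sgn u (u ! i # ?d i) * word_sgn (u ! i # ?d i) (u ! i # r)"
      using d mset_d[OF i] \<open>mset r = _\<close> by (intro word_sgn_trans) auto
    also have "word_sgn u (u ! i # ?d i) = (-1) ^ i"
      using word_sgn_move[of "take i u" "u ! i" "drop (Suc i) u"] u[OF i] d i by simp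
    also have "word_sgn (u ! i # ?d i) (u ! i # r) = word_sgn (?d i) r"
      using dist_d[OF i] \<open>mset r = _\<close> by (intro word_sgn_Cons) auto
    also have "of_int ((-1) ^ i * word_sgn (?d i) r) * pair_prod f (x # u ! i # r)
        = (-1) ^ i * (f x (u ! i) * (of_int (word_sgn (?d i) r) * pair_prod f r))"
      by simp
    also have "of_int (word_sgn (?d i) r) * pair_prod f r = pf_term T (?d i) M"
      using T r dist_d[OF i] set_d[OF i]
      by (intro pf_term_listing[OF anti, symmetric]) (auto simp: lists_pairs_iff)
    finally show ?thesis .
  qed
  have fin: "finite (?P i)" for i
    by (rule finite_subset[of _ "Pow (Pow (set (?d i)))"])
       (auto simp: pair_partitions_def partition_on_def)
  have "pf T (x # u) = (\<Sum>M\<in>?h ` (SIGMA i:{..<length u}. ?P i). pf_term T (x # u) M)"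
    using d odd unfolding img by (simp add: pf_def)
  also have "\<dots> = (\<Sum>(i, M)\<in>(SIGMA i:{..<length u}. ?P i). pf_term T (x # u) (?h (i, M)))"
    using inj by (subst sum.reindex) (auto simp: case_prod_beta intro!: sum.cong)
  also have "\<dots> = (\<Sum>i<length u. \<Sum>M\<in>?P i. pf_term T (x # u) (?h (i, M)))"
    using fin by (subst sum.Sigma) auto
  also have "\<dots> = (\<Sum>i<length u. (-1) ^ i * (f x (u ! i) * (\<Sum>M\<in>?P i. pf_term T (?d i) M)))"
    using term_eq by (simp add: sum_distrib_left)
  also have "\<dots> = (\<Sum>i<length u. (-1) ^ i * (f x (u ! i) * pf T (?d i)))"
    using dist_d odd by (intro sum.cong) (auto simp: pf_def)
  finally show ?thesis .
qed

text \<open>On distinct words of even length both sides obey the expansion along the first letter.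
  On all others \<open>pf\<close> is 0 by definition, and \<open>pfaffian\<close> by
  \<open>pfaffian_odd\<close> or \<open>pfaffian_not_distinct\<close>.\<close>

lemma pf_eq_pfaffian:
  assumes diag: "\<And>x. f x x = 0" and anti: "\<And>x y. f y x = - f x y"
    and "\<And>x y. x \<in> set w \<Longrightarrow> y \<in> set w \<Longrightarrow> T $$ (x, y) = f x y"
  shows "pf T w = pfaffian f w"
proof (cases "distinct w \<and> even (length w)")
  case True
  with assms(3) show ?thesis
  proof (induction w rule: length_induct)
    case (1 w)
    show ?case
    proof (cases w)
      case Nil
      then show ?thesis by (simp add: pf_Nil)
    next
      case (Cons x u)
      have "pf T (take i u @ drop (Suc i) u) = pfaffian f (take i u @ drop (Suc i) u)" (is "pf T ?d = _")
        if "i < length u" for i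
      proof -
        have sub: "set ?d \<subseteq> set u"
          by (auto dest: in_set_takeD in_set_dropD)
        show ?thesis
        proof (rule 1(1)[rule_format])
          show "length ?d < length w" using Cons that by simp
          show "T $$ (a, b) = f a b" if "a \<in> set ?d" "b \<in> set ?d" for a b
            using 1(2)[of a b] that sub Cons by (metis list.set_intros(2) subsetD)
          show "distinct ?d \<and> even (length ?d)"
            using 1(3) Cons that by (auto simp: set_take_disj_set_drop_if_distinct)
        qed
      qed
      moreover have "pf T (x # u) =
          (\<Sum>i<length u. (-1) ^ i * (f x (u ! i) * pf T (take i u @ drop (Suc i) u)))"
        using 1(2,3) Cons by (intro pf_Cons[OF anti]) auto
      ultimately show ?thesis by (simp add: Cons pfaffian.simps(2))
    qed
  qed
next
  case False
  then show ?thesis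
    using pfaffian_odd[of w f] pfaffian_not_distinct[of f w, OF diag anti] by (metis pf_def)
qed

section \<open>Submatrices as minors labelled by words, and the theorem\<close>

lemma pick_eq_sorted_list:
  assumes "finite I" "k < card I"
  shows "pick I k = sorted_list_of_set I ! k"
proof -
  let ?l = "sorted_list_of_set I"
  have k: "k < length ?l" using assms by simp
  have lt: "?l ! i < ?l ! j \<longleftrightarrow> i < j" if "i < length ?l" "j < length ?l" for i j
    using that sorted_wrt_nth_less[OF strict_sorted_list_of_set, of _ _ I]
    by (metis less_asym' linorder_neqE_nat order_less_irrefl)
  \<comment> \<open>An element of \<open>I\<close> is picked at the index that counts the smaller
    elements of \<open>I\<close>.\<close>
  have "{a \<in> I. a < ?l ! k} = (!) ?l ` {..<k}"
  proof (intro equalityI subsetI)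
    fix a assume "a \<in> {a \<in> I. a < ?l ! k}"
    then have "a \<in> set ?l" "a < ?l ! k" using assms(1) by auto
    then obtain i where "i < length ?l" "a = ?l ! i" "?l ! i < ?l ! k"
      by (metis in_set_conv_nth)
    then show "a \<in> (!) ?l ` {..<k}" using lt k by auto
  next
    fix a assume "a \<in> (!) ?l ` {..<k}"
    then obtain i where "i < k" "a = ?l ! i" by auto
    then show "a \<in> {a \<in> I. a < ?l ! k}"
      using lt[of i k] k assms(1) nth_mem[of i ?l] by auto
  qed
  moreover have "inj_on ((!) ?l) {..<k}"
    using k by (intro inj_on_nth) auto
  ultimately have "card {a \<in> I. a < ?l ! k} = k"
    by (simp add: card_image)
  moreover have "?l ! k \<in> I" using nth_mem[OF k] assms(1) by simp
  ultimately show ?thesis using pick_card_in_set by metis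
qed

theorem theorem1:
  fixes T :: "'a::comm_ring_1 mat" and n m :: nat and R S :: "nat set" and \<rho> \<sigma> :: "nat list"
  assumes "n \<ge> 1"
    and "T \<in> carrier_mat n n"
    and "\<And>i j. i < n \<Longrightarrow> j < n \<Longrightarrow> T $$ (j, i) = - T $$ (i, j)"
    and "\<And>i. i < n \<Longrightarrow> T $$ (i, i) = 0"
    and "R \<subseteq> {0..<n}" and "S \<subseteq> {0..<n}"
    and "card R = m" and "card S = m"
    and "\<rho> = sorted_list_of_set R" and "\<sigma> = sorted_list_of_set S"
  shows "det (submatrix T R S) =
    (-1) ^ (m div 2) *
    (\<Sum>k = 0..m div 2. (-1) ^ k *
      (\<Sum>\<omega> | length \<omega> = 2 * k \<and> subseq \<omega> \<rho>.
        of_int (word_sgn \<rho> (\<omega> @ word_minus \<rho> \<omega>)) *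
        pf T \<omega> * pf T (word_minus \<rho> \<omega> @ \<sigma>)))"
proof -
  \<comment> \<open>The value 0 outside the matrix makes \<open>f\<close> alternating on all of
    \<open>nat\<close>.\<close>
  define f where "f i j = (if i < n \<and> j < n then T $$ (i, j) else 0)" for i j
  have pf: "pf T w = pfaffian f w" if "set w \<subseteq> {0..<n}" for w
  proof (rule pf_eq_pfaffian)
    show "f j i = - f i j" for i j using assms(3)[of i j] by (simp add: f_def)
  qed (use that assms(4) in \<open>auto simp: f_def\<close>)
  have fin: "finite R" "finite S" using assms(5,6) by (auto intro: finite_subset)
  have len: "length \<rho> = m" "length \<sigma> = m" using assms(7-10) by auto
  have sets: "set \<rho> = R" "set \<sigma> = S" and dist: "distinct \<rho>" using fin assms(9,10) by auto
  have "{i. i < n \<and> i \<in> R} = R" "{i. i < n \<and> i \<in> S} = S" using assms(5,6) by auto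
  then have "submatrix T R S = minor_of f \<rho> \<sigma>"
    using assms(2,5-8) fin len sets nth_mem[of _ \<rho>] nth_mem[of _ \<sigma>]
    by (intro eq_matI)
       (auto simp: submatrix_def minor_of_def pick_eq_sorted_list f_def assms(9,10) subset_iff)
  \<comment> \<open>The sign of \<open>pf_split_eq_det\<close> changes sides because its square is
    1.\<close>
  then have "det (submatrix T R S) = (-1) ^ (m div 2) * pf_split f \<rho> \<sigma>"
    using pf_split_eq_det[of \<sigma> \<rho> f] len by (simp add: mult.assoc[symmetric] flip: power_add mult_2)
  also have "pf_split f \<rho> \<sigma> = (\<Sum>k = 0..m div 2. (-1) ^ k *
      (\<Sum>\<omega> | length \<omega> = 2 * k \<and> subseq \<omega> \<rho>.
        of_int (word_sgn \<rho> (\<omega> @ word_minus \<rho> \<omega>)) *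
        pf T \<omega> * pf T (word_minus \<rho> \<omega> @ \<sigma>)))" (is "_ = (\<Sum>k = 0..m div 2. (-1) ^ k * sum ?g _)")
  proof -
    let ?E = "{\<omega>. subseq \<omega> \<rho> \<and> even (length \<omega>)}"
    let ?c = "\<lambda>\<omega>. (-1) ^ (length \<omega> div 2) * ?g \<omega>"
    have g: "of_int (word_sgn \<rho> (\<omega> @ word_minus \<rho> \<omega>)) * ((-1) ^ (length \<omega> div 2) *
        (pfaffian f \<omega> * pfaffian f (word_minus \<rho> \<omega> @ \<sigma>))) = ?c \<omega>" if "subseq \<omega> \<rho>" for \<omega>
    proof -
      have "set \<omega> \<subseteq> set \<rho>" using that by (auto dest: list_emb_set)
      then have "set \<omega> \<subseteq> {0..<n}" using sets assms(5) by simp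
      moreover have "set (word_minus \<rho> \<omega> @ \<sigma>) \<subseteq> {0..<n}"
        using sets assms(5,6) by (auto simp: word_minus_def)
      ultimately show ?thesis by (simp add: pf mult_ac)
    qed
    have "pf_split f \<rho> \<sigma> = (\<Sum>\<omega> | subseq \<omega> \<rho>. ?c \<omega>)"
      unfolding pf_split_def split_sum_eq_sum[OF dist] by (rule sum.cong) (auto simp: g)
    \<comment> \<open>Subwords of odd length drop out since \<open>pf\<close> vanishes on
      them.\<close>
    also have "\<dots> = (\<Sum>\<omega>\<in>?E. ?c \<omega>)"
      by (rule sum.mono_neutral_right) (auto simp: finite_subseq pf_def)
    \<comment> \<open>Grouping by \<open>k = length \<omega> div 2\<close>, which on
      \<open>?E\<close> means \<open>length \<omega> = 2 * k\<close>; the bound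
      \<open>m div 2\<close> holds as a subword is no longer than \<open>\<rho>\<close>.\<close>
    also have "\<dots> = (\<Sum>k = 0..m div 2. \<Sum>\<omega> | \<omega> \<in> ?E \<and> length \<omega> div 2 = k. ?c \<omega>)"
      using len
      by (intro sum.group[symmetric])
         (auto intro: finite_subset[OF _ finite_subseq] div_le_mono dest: list_emb_length)
    also have "\<dots> = (\<Sum>k = 0..m div 2. (-1) ^ k * sum ?g {\<omega>. length \<omega> = 2 * k \<and> subseq \<omega> \<rho>})"
      unfolding sum_distrib_left by (intro sum.cong) auto
    finally show ?thesis .
  qed
  finally show ?thesis .
qed

end
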